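(* For every pair of integers $a\ge 1$ and $b\ge 2$, there are arbitrarily large graphs $G$, of order denoted $n$, such that $$\eta(G)=a,\qquad \eta_\ell(G)\ge b,\qquad\text{and}\qquad \delta(G)=n-\sqrt{\frac{2n}{2a-1}}+O(1).$$ That is, for every such $a,b$ there is a constant $C$ (depending only on $a,b$) such that for every $n_0$ there is a graph $G$ of order $n\ge n_0$ with $\eta(G)=a$, $\eta_\ell(G)\ge b$, and $\left|\delta(G)-n+\sqrt{\frac{2n}{2a-1}}\right|\le C$.
   Context: All graphs are finite and simple; $\delta(G)$ is the minimum degree of $G$, and the order of $G$ is $|V(G)|$. $\mathbb N$ denotes the positive integers and $[k]=\{1,2,\ldots,k\}$. For a graph $G$ and a labeling $\ell:V(G)\to\mathbb N$, put $S_\ell(v)=\sum_{w\in N(v)}\ell(w)$, where $N(v)$ is the open neighborhood of $v$. The labeling $\ell$ is an additive labeling if $S_\ell(u)\ne S_\ell(v)$ for every edge $uv\in E(G)$. The additive number $\eta(G)$ is the least positive integer $k$ such that $G$ has an additive labeling $\ell:V(G)\to[k]$. The list additive number $\eta_\ell(G)$ is the least positive integer $k$ such that for every assignment of $k$-element lists $L(v)\subset\mathbb N$ to the vertices $v\in V(G)$ there is an additive labeling $\ell$ of $G$ with $\ell(v)\in L(v)$ for every vertex $v$. (The subscript in $\eta_\ell(G)$ is only notation and does not refer to a particular labeling.) *)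

theory Defs
  imports Complex_Main "Graph_Theory.Pair_Digraph"
begin

(* A finite simple graph is a pair_graph: a finite, loop-free, symmetric digraph whose
   arcs are ordered pairs, so that an edge uv is the pair of arcs (u,v), (v,u). *)

definition neighborhood :: "'a pair_pre_digraph \<Rightarrow> 'a \<Rightarrow> 'a set" where
  "neighborhood G v = {w. (v, w) \<in> parcs G}"

(* By symmetry, the out-degree is the usual degree. The value is meaningful only if the
   vertex set is nonempty. *)
definition min_degree :: "'a pair_pre_digraph \<Rightarrow> nat" where
  "min_degree G = Min (out_degree (with_proj G) ` pverts G)"

definition nbr_sum :: "'a pair_pre_digraph \<Rightarrow> ('a \<Rightarrow> nat) \<Rightarrow> 'a \<Rightarrow> nat" where
  "nbr_sum G l v = (\<Sum>w\<in>neighborhood G v. l w)"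

definition additive_labeling :: "'a pair_pre_digraph \<Rightarrow> ('a \<Rightarrow> nat) \<Rightarrow> bool" where
  "additive_labeling G l \<longleftrightarrow>
     (\<forall>v\<in>pverts G. 1 \<le> l v) \<and> (\<forall>(u, v)\<in>parcs G. nbr_sum G l u \<noteq> nbr_sum G l v)"

definition additive_number :: "'a pair_pre_digraph \<Rightarrow> nat" where
  "additive_number G =
     (LEAST k. 1 \<le> k \<and> (\<exists>l. additive_labeling G l \<and> (\<forall>v\<in>pverts G. l v \<in> {1..k})))"

(* Both minima are attained for every finite simple graph: label the vertices one by one
   and settle an edge uv when the last vertex lying in exactly one of the neighborhoods of
   u and v is labeled. Each edge then forbids at most one label at one vertex, so every
   k larger than the number of edges is admissible. *)
definition list_additive_number :: "'a pair_pre_digraph \<Rightarrow> nat" where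
  "list_additive_number G =
     (LEAST k. 1 \<le> k \<and>
        (\<forall>L :: 'a \<Rightarrow> nat set.
           (\<forall>v\<in>pverts G. L v \<subseteq> {1..} \<and> card (L v) = k) \<longrightarrow>
           (\<exists>l. additive_labeling G l \<and> (\<forall>v\<in>pverts G. l v \<in> L v))))"

end

(*
  Pass to the complement: labels are additive iff the sums over closed complement-neighborhoods
  differ for any two vertices that are not adjacent in the complement. The complement of the
  graph consists of cliques, (a - 1) t + 1 of size t and one of each size s < t exceeding the order of a
  fixed gadget, and of this gadget. The sums of the cliques of size t can be t, ..., a t with labels
  up to a but cannot be distinct with smaller ones, and the maximal closed degree of the complement is t.

  For k = b - 1 the gadget has distinct closed degrees at nonadjacent vertices, so the constant
  labeling is additive on it, but it is not k-choosable. It consists of two cliques whose vertices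
  see prefixes of a chain of core vertices and, respectively, all subsets of a second set of core
  vertices. The lists of the second set are {1..k}, so some label p occurs often and
  the subset sums contain a long run of multiples of p; those of the chain contain only numbers
  congruent to 1 modulo k!, so the prefix sums run through all residues modulo p. Hence a
  prefix sum and a subset sum coincide, whatever offset the sums of the two cliques produce.
*)
theory Submission
  imports Defs
begin

subsection \<open>Graphs given by their complement\<close>

text \<open>\<open>r\<close> is meant to be reflexive: then \<open>\<not> r u v\<close> excludes
  loops, and \<open>{w\<in>V. r v w}\<close> is a closed neighborhood in the complement.\<close>

definition co_graph :: "'v set \<Rightarrow> ('v \<Rightarrow> 'v \<Rightarrow> bool) \<Rightarrow> 'v pair_pre_digraph" where
  "co_graph V r = \<lparr>pverts = V, parcs = {(u, v). u \<in> V \<and> v \<in> V \<and> \<not> r u v}\<rparr>"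

definition closed_sum :: "'v set \<Rightarrow> ('v \<Rightarrow> 'v \<Rightarrow> bool) \<Rightarrow> ('v \<Rightarrow> nat) \<Rightarrow> 'v \<Rightarrow> nat" where
  "closed_sum V r l v = (\<Sum>w\<in>{w\<in>V. r v w}. l w)"

lemma co_graph_simps [simp]:
  "pverts (co_graph V r) = V"
  "(u, v) \<in> parcs (co_graph V r) \<longleftrightarrow> u \<in> V \<and> v \<in> V \<and> \<not> r u v"
  by (auto simp: co_graph_def)

lemma pair_graph_co_graph:
  assumes "finite V" "reflp_on V r" "symp_on V r"
  shows "pair_graph (co_graph V r)"
proof
  have "parcs (co_graph V r) \<subseteq> V \<times> V"
    by (auto simp: co_graph_def)
  then show "finite (parcs (co_graph V r))"
    using assms(1) by (meson finite_SigmaI finite_subset)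
  show "symmetric (with_proj (co_graph V r))"
    using assms(3) by (auto simp: symmetric_def intro!: symI dest: symp_onD)
qed (use assms in \<open>auto simp: co_graph_def dest: reflp_onD\<close>)

text \<open>The neighbors of \<open>v\<close> and its closed neighborhood in the complement
  partition \<open>V\<close>, so comparing neighbor sums amounts to comparing closed sums.\<close>

lemma nbr_sum_co_graph:
  assumes "finite V" "v \<in> V"
  shows "nbr_sum (co_graph V r) l v + closed_sum V r l v = (\<Sum>w\<in>V. l w)"
proof -
  have "neighborhood (co_graph V r) v = V - {w\<in>V. r v w}"
    using assms(2) by (auto simp: neighborhood_def)
  then show ?thesis
    unfolding nbr_sum_def closed_sum_def using assms(1)
    by (simp add: sum.subset_diff[of "{w\<in>V. r v w}" V])
qed

lemma additive_labeling_iff: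
  "additive_labeling G l \<longleftrightarrow> (\<forall>v\<in>pverts G. 1 \<le> l v) \<and>
     (\<forall>u v. (u, v) \<in> parcs G \<longrightarrow> nbr_sum G l u \<noteq> nbr_sum G l v)"
  unfolding additive_labeling_def by auto

lemma additive_labeling_co_graph:
  assumes "finite V"
  shows "additive_labeling (co_graph V r) l \<longleftrightarrow>
    (\<forall>v\<in>V. 1 \<le> l v) \<and>
    (\<forall>u\<in>V. \<forall>v\<in>V. \<not> r u v \<longrightarrow> closed_sum V r l u \<noteq> closed_sum V r l v)"
proof -
  have "nbr_sum (co_graph V r) l u = nbr_sum (co_graph V r) l v \<longleftrightarrow>
      closed_sum V r l u = closed_sum V r l v" if "u \<in> V" "v \<in> V" for u v
    using nbr_sum_co_graph[OF assms that(1), of r l] nbr_sum_co_graph[OF assms that(2), of r l]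
    by linarith
  then show ?thesis
    by (auto simp: additive_labeling_iff)
qed

lemma out_degree_with_proj: "out_degree (with_proj G) v = card (neighborhood G v)"
proof -
  have "out_arcs (with_proj G) v = Pair v ` neighborhood G v"
    by (auto simp: out_arcs_def neighborhood_def)
  then show ?thesis
    by (simp add: out_degree_def card_image inj_on_def)
qed

lemma min_degree_co_graph:
  assumes "finite V"
    and le: "\<And>v. v \<in> V \<Longrightarrow> card {w\<in>V. r v w} \<le> t"
    and ex: "v0 \<in> V" "card {w\<in>V. r v0 w} = t"
  shows "min_degree (co_graph V r) + t = card V"
proof -
  have deg: "out_degree (with_proj (co_graph V r)) v = card V - card {w\<in>V. r v w}" if "v \<in> V" for v
  proof -
    have "neighborhood (co_graph V r) v = V - {w\<in>V. r v w}"
      using that by (auto simp: neighborhood_def)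
    then show ?thesis
      using assms(1) by (simp add: out_degree_with_proj card_Diff_subset)
  qed
  have "min_degree (co_graph V r) = card V - t"
    unfolding min_degree_def
  proof (rule Min_eqI)
    show "finite (out_degree (with_proj (co_graph V r)) ` pverts (co_graph V r))"
      using assms(1) by simp
    show "card V - t \<in> out_degree (with_proj (co_graph V r)) ` pverts (co_graph V r)"
      using ex deg[OF ex(1)] by (force simp: image_iff)
  qed (use le deg in \<open>auto simp: diff_le_mono2\<close>)
  moreover have "t \<le> card V"
    using ex card_mono[OF assms(1), of "{w\<in>V. r v0 w}"] by auto
  ultimately show ?thesis by simp
qed

subsection \<open>Invariance under renaming of vertices\<close>

text \<open>The construction lives on a sum type; renaming moves it to graphs on
  \<open>nat\<close>.\<close>

definition map_graph :: "('v \<Rightarrow> 'w) \<Rightarrow> 'v pair_pre_digraph \<Rightarrow> 'w pair_pre_digraph" where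
  "map_graph f G = \<lparr>pverts = f ` pverts G, parcs = map_prod f f ` parcs G\<rparr>"

lemma map_graph_simps [simp]:
  "pverts (map_graph f G) = f ` pverts G"
  "parcs (map_graph f G) = map_prod f f ` parcs G"
  by (auto simp: map_graph_def)

lemma pair_graph_map_graph:
  assumes "pair_graph G" "inj_on f (pverts G)"
  shows "pair_graph (map_graph f G)"
proof -
  interpret pair_graph G by fact
  have s: "(v, u) \<in> parcs G" if "(u, v) \<in> parcs G" for u v
    using that pair_sym_arcs by (auto simp: symmetric_def dest: symD)
  show ?thesis
  proof
    show "symmetric (with_proj (map_graph f G))"
      unfolding symmetric_def with_proj_simps map_graph_simps
      by (rule symI) (use s in \<open>fastforce simp: image_iff\<close>)
    show "fst e \<noteq> snd e" if "e \<in> parcs (map_graph f G)" for e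
    proof -
      from that obtain u v where "(u, v) \<in> parcs G" "e = (f u, f v)" by auto
      then show ?thesis
        using assms(2) pair_no_loops in_arcsD1 in_arcsD2 by (metis fst_conv inj_onD snd_conv)
    qed
  qed (auto dest: in_arcsD1 in_arcsD2 simp: pair_finite_verts pair_finite_arcs)
qed

lemma neighborhood_map_graph:
  assumes "pair_graph G" "inj_on f (pverts G)" "v \<in> pverts G"
  shows "neighborhood (map_graph f G) (f v) = f ` neighborhood G v"
proof -
  interpret pair_graph G by fact
  show ?thesis
  proof (intro equalityI subsetI)
    fix y assume "y \<in> neighborhood (map_graph f G) (f v)"
    then obtain u w where "(u, w) \<in> parcs G" "f v = f u" "y = f w"
      by (auto simp: neighborhood_def)
    then show "y \<in> f ` neighborhood G v"
      using assms(2,3) in_arcsD1 by (metis inj_onD imageI mem_Collect_eq neighborhood_def)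
  qed (force simp: neighborhood_def)
qed

lemma neighborhood_subset:
  assumes "pair_graph G"
  shows "neighborhood G v \<subseteq> pverts G"
proof -
  interpret pair_graph G by fact
  show ?thesis by (auto simp: neighborhood_def dest: in_arcsD2)
qed

lemma min_degree_map_graph:
  assumes "pair_graph G" "inj_on f (pverts G)"
  shows "min_degree (map_graph f G) = min_degree G"
proof -
  have "out_degree (with_proj (map_graph f G)) (f v) = out_degree (with_proj G) v"
    if "v \<in> pverts G" for v
    using neighborhood_map_graph[OF assms that] neighborhood_subset[OF assms(1)]
    by (simp add: out_degree_with_proj card_image inj_on_subset[OF assms(2)])
  then have "out_degree (with_proj (map_graph f G)) ` f ` pverts G
      = out_degree (with_proj G) ` pverts G"
    by (auto simp: image_iff)
  then show ?thesis
    by (simp add: min_degree_def)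
qed

lemma additive_labeling_map_graph:
  assumes "pair_graph G" "inj_on f (pverts G)"
  shows "additive_labeling (map_graph f G) l \<longleftrightarrow> additive_labeling G (l \<circ> f)"
proof -
  interpret pair_graph G by fact
  have "nbr_sum (map_graph f G) l (f v) = nbr_sum G (l \<circ> f) v" if "v \<in> pverts G" for v
    using neighborhood_map_graph[OF assms that] neighborhood_subset[OF assms(1)]
    by (simp add: nbr_sum_def sum.reindex inj_on_subset[OF assms(2)])
  then have "nbr_sum (map_graph f G) l (f u) = nbr_sum (map_graph f G) l (f v) \<longleftrightarrow>
      nbr_sum G (l \<circ> f) u = nbr_sum G (l \<circ> f) v" if "(u, v) \<in> parcs G" for u v
    using that by (simp add: in_arcsD1 in_arcsD2)
  moreover have "(x, y) \<in> map_prod f f ` parcs G \<longleftrightarrow>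
      (\<exists>u v. (u, v) \<in> parcs G \<and> x = f u \<and> y = f v)" for x y
    by auto
  ultimately show ?thesis
    unfolding additive_labeling_iff map_graph_simps comp_def ball_simps by metis
qed

lemma additive_labeling_cong:
  assumes "pair_graph G" "\<And>v. v \<in> pverts G \<Longrightarrow> l v = l' v"
  shows "additive_labeling G l \<longleftrightarrow> additive_labeling G l'"
proof -
  interpret pair_graph G by fact
  have "nbr_sum G l v = nbr_sum G l' v" for v
    unfolding nbr_sum_def using neighborhood_subset[OF assms(1)] assms(2)
    by (intro sum.cong) auto
  then show ?thesis
    unfolding additive_labeling_def using assms(2) by auto
qed

section \<open>List labelings and choosability\<close>

definition list_labelable :: "'v pair_pre_digraph \<Rightarrow> ('v \<Rightarrow> nat set) \<Rightarrow> bool" where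
  "list_labelable G L \<longleftrightarrow> (\<exists>l. additive_labeling G l \<and> (\<forall>v\<in>pverts G. l v \<in> L v))"

lemma list_labelable_map_graph:
  assumes "pair_graph G" "inj_on f (pverts G)"
  shows "list_labelable (map_graph f G) L \<longleftrightarrow> list_labelable G (L \<circ> f)"
proof
  assume "list_labelable G (L \<circ> f)"
  then obtain l where l: "additive_labeling G l" "\<forall>v\<in>pverts G. l v \<in> L (f v)"
    by (auto simp: list_labelable_def)
  let ?l = "l \<circ> inv_into (pverts G) f"
  have "additive_labeling (map_graph f G) ?l"
    unfolding additive_labeling_map_graph[OF assms]
    using l(1) additive_labeling_cong[OF assms(1), of "?l \<circ> f" l] assms(2) by simp
  then show "list_labelable (map_graph f G) L"
    unfolding list_labelable_def using l(2) assms(2) by (intro exI[of _ ?l]) auto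
qed (auto simp: list_labelable_def additive_labeling_map_graph[OF assms] comp_def)

lemma additive_number_eq:
  "additive_number G = (LEAST k. 1 \<le> k \<and> list_labelable G (\<lambda>_. {1..k}))"
  by (simp add: additive_number_def list_labelable_def)

lemma list_labelable_mono:
  assumes "list_labelable G L" "\<And>v. v \<in> pverts G \<Longrightarrow> L v \<subseteq> L' v"
  shows "list_labelable G L'"
  using assms unfolding list_labelable_def by blast

definition choosable :: "'v pair_pre_digraph \<Rightarrow> nat \<Rightarrow> bool" where
  "choosable G k \<longleftrightarrow>
     (\<forall>L. (\<forall>v\<in>pverts G. L v \<subseteq> {1..} \<and> card (L v) = k) \<longrightarrow> list_labelable G L)"

lemma list_additive_number_eq:
  "list_additive_number G = (LEAST k. 1 \<le> k \<and> choosable G k)"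
  by (simp add: list_additive_number_def choosable_def list_labelable_def)

text \<open>Shrink every list to \<open>k\<close> of its elements. Thus choosability is a threshold
  property, and one failing \<open>k\<close> bounds the list additive number from below.\<close>

lemma choosable_mono:
  assumes "choosable G k" "k \<le> k'"
  shows "choosable G k'"
  unfolding choosable_def
proof (intro allI impI)
  fix L :: "'a \<Rightarrow> nat set"
  assume L: "\<forall>v\<in>pverts G. L v \<subseteq> {1..} \<and> card (L v) = k'"
  then have "\<forall>v\<in>pverts G. \<exists>S. S \<subseteq> L v \<and> card S = k"
    using assms(2) by (metis obtain_subset_with_card_n)
  then obtain L' where L': "\<forall>v\<in>pverts G. L' v \<subseteq> L v \<and> card (L' v) = k"
    by metis
  then have "list_labelable G L'"
    using L assms(1) unfolding choosable_def by (meson order_trans)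
  then show "list_labelable G L"
    using L' list_labelable_mono by metis
qed

lemma choosable_map_graph:
  assumes "pair_graph G" "inj_on f (pverts G)"
  shows "choosable (map_graph f G) k \<longleftrightarrow> choosable G k"
proof
  assume c: "choosable (map_graph f G) k"
  show "choosable G k"
    unfolding choosable_def
  proof (intro allI impI)
    fix L :: "'a \<Rightarrow> nat set"
    assume L: "\<forall>v\<in>pverts G. L v \<subseteq> {1..} \<and> card (L v) = k"
    let ?L = "L \<circ> inv_into (pverts G) f"
    have "list_labelable (map_graph f G) ?L"
      using c L assms(2) unfolding choosable_def by auto
    then have "list_labelable G (?L \<circ> f)"
      by (simp add: list_labelable_map_graph[OF assms])
    then show "list_labelable G L"
      by (rule list_labelable_mono) (use assms(2) in auto)
  qed
qed (auto simp: choosable_def list_labelable_map_graph[OF assms])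

lemma additive_number_map_graph:
  assumes "pair_graph G" "inj_on f (pverts G)"
  shows "additive_number (map_graph f G) = additive_number G"
  by (simp add: additive_number_eq list_labelable_map_graph[OF assms] comp_def)

lemma list_additive_number_map_graph:
  assumes "pair_graph G" "inj_on f (pverts G)"
  shows "list_additive_number (map_graph f G) = list_additive_number G"
  by (simp add: list_additive_number_eq choosable_map_graph[OF assms])

text \<open>
  The labels are fixed one vertex at a time; each form becomes a constant when its last
  vertex is treated, so it forbids at most one label at one vertex.
\<close>

lemma avoid_linear_forms:
  fixes c :: "'e \<Rightarrow> 'v \<Rightarrow> int" and d :: "'e \<Rightarrow> int" and L :: "'v \<Rightarrow> nat set"
  assumes "finite V" "finite E"
    and "\<And>e. e \<in> E \<Longrightarrow> d e \<noteq> 0 \<or> (\<exists>v\<in>V. c e v \<noteq> 0)"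
    and "\<And>v. v \<in> V \<Longrightarrow> card E < card (L v)"
  shows "\<exists>l. (\<forall>v\<in>V. l v \<in> L v) \<and> (\<forall>e\<in>E. d e + (\<Sum>v\<in>V. c e v * int (l v)) \<noteq> 0)"
  using assms(1,3,4)
proof (induction V arbitrary: d rule: finite_induct)
  case empty
  then show ?case by simp
next
  case (insert x V)
  \<comment> \<open>Outside \<open>bad\<close>, every form that involves \<open>x\<close> keeps a
    nonzero constant, so the hypothesis passes to \<open>V\<close> with
    \<open>d e + c e x * int y\<close> in place of \<open>d e\<close>; each form excludes at most
    one \<open>y\<close>.\<close>
  define bad where "bad = {y. \<exists>e\<in>E. c e x \<noteq> 0 \<and> d e + c e x * int y = 0}"
  have sub: "bad \<subseteq> (\<lambda>e. nat (- d e div c e x)) ` E"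
  proof
    fix y assume "y \<in> bad"
    then obtain e where e: "e \<in> E" "c e x \<noteq> 0" "d e + c e x * int y = 0"
      by (auto simp: bad_def)
    then have "- d e = c e x * int y" by simp
    then have "nat (- d e div c e x) = y" using e(2) by simp
    then show "y \<in> (\<lambda>e. nat (- d e div c e x)) ` E" using e(1) by blast
  qed
  then have "card bad < card (L x)"
    using insert.prems(2)[of x] surj_card_le[OF assms(2) sub] by simp
  moreover have "finite bad" using sub assms(2) finite_subset by blast
  ultimately obtain y where y: "y \<in> L x" "y \<notin> bad"
    by (meson card_mono linorder_not_less subsetI)
  have "d e + c e x * int y \<noteq> 0 \<or> (\<exists>v\<in>V. c e v \<noteq> 0)" if "e \<in> E" for e
    using that insert.prems(1)[OF that] y(2) by (auto simp: bad_def)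
  from insert.IH[OF this] insert.prems(2) obtain l where
    l: "\<forall>v\<in>V. l v \<in> L v"
       "\<forall>e\<in>E. (d e + c e x * int y) + (\<Sum>v\<in>V. c e v * int (l v)) \<noteq> 0"
    by auto
  have eq: "(\<Sum>v\<in>V. c e v * int ((l(x := y)) v)) = (\<Sum>v\<in>V. c e v * int (l v))" for e
    using insert.hyps by (intro sum.cong) auto
  show ?case
    using l y(1) insert.hyps eq by (intro exI[of _ "l(x := y)"]) (auto simp: add.assoc)
qed

text \<open>Ensures that the minimum defining the list additive number is attained. Each arc
  contributes one linear form, so lists longer than the number of arcs suffice.\<close>

lemma choosable_exists:
  assumes "pair_graph G"
  shows "\<exists>k\<ge>1. choosable G k"
proof -
  interpret pair_graph G by fact
  \<comment> \<open>\<open>c (u, v)\<close> holds the coefficients of the difference of the neighbor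
    sums of \<open>u\<close> and \<open>v\<close>.\<close>
  define c :: "'a \<times> 'a \<Rightarrow> 'a \<Rightarrow> int" where
    "c = (\<lambda>(u, v) w. of_bool ((u, w) \<in> parcs G) - of_bool ((v, w) \<in> parcs G))"
  have "choosable G (Suc (card (parcs G)))"
    unfolding choosable_def
  proof (intro allI impI)
    fix L :: "'a \<Rightarrow> nat set"
    assume L: "\<forall>v\<in>pverts G. L v \<subseteq> {1..} \<and> card (L v) = Suc (card (parcs G))"
    \<comment> \<open>The form of \<open>(u, v)\<close> has coefficient 1 at \<open>v\<close>, which
      is a neighbor of \<open>u\<close> but not of itself.\<close>
    have "0 \<noteq> (0::int) \<or> (\<exists>w\<in>pverts G. c e w \<noteq> 0)" if "e \<in> parcs G" for e
      using that pair_no_loops[of "(snd e, snd e)"] in_arcsD2[of "fst e" "snd e"]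
      by (intro disjI2 bexI[of _ "snd e"]) (auto simp: c_def split: prod.splits)
    from avoid_linear_forms[of "pverts G" "parcs G" "\<lambda>_. 0" c L, OF _ _ this] L
    obtain l where l: "\<forall>v\<in>pverts G. l v \<in> L v"
      "\<forall>e\<in>parcs G. (\<Sum>v\<in>pverts G. c e v * int (l v)) \<noteq> 0"
      by (auto simp: pair_finite_verts pair_finite_arcs)
    have s: "int (nbr_sum G l u) = (\<Sum>w\<in>pverts G. int (l w) * of_bool ((u, w) \<in> parcs G))" for u
      unfolding nbr_sum_def of_nat_sum
      by (rule sum.mono_neutral_cong_left)
        (auto simp: neighborhood_def pair_finite_verts intro: in_arcsD2)
    have "nbr_sum G l u \<noteq> nbr_sum G l v" if "(u, v) \<in> parcs G" for u v
    proof
      assume "nbr_sum G l u = nbr_sum G l v"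
      then have "(\<Sum>w\<in>pverts G. c (u, v) w * int (l w)) = 0"
        using s[of u] s[of v] by (simp add: c_def algebra_simps sum_subtractf)
      then show False using l(2) that by blast
    qed
    moreover have "\<forall>v\<in>pverts G. 1 \<le> l v"
      using l(1) L by (meson atLeast_iff subsetD)
    ultimately show "list_labelable G L"
      using l(1) unfolding list_labelable_def additive_labeling_def by blast
  qed
  then show ?thesis by (intro exI[of _ "Suc (card (parcs G))"]) simp
qed

lemma list_additive_number_gt:
  assumes "pair_graph G" "\<not> choosable G k"
  shows "k < list_additive_number G"
proof -
  have "choosable G (list_additive_number G)"
    unfolding list_additive_number_eq
    using LeastI_ex[of "\<lambda>k. 1 \<le> k \<and> choosable G k"] choosable_exists[OF assms(1)] by auto
  then show ?thesis
    using choosable_mono assms(2) not_le_imp_less by blast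
qed

subsection \<open>Adding cliques to the complement\<close>

text \<open>Hermite's identity at \<open>i / m\<close>: it writes \<open>i\<close> as a sum of
  \<open>m\<close> nearly equal labels. Passing to \<open>Suc i\<close> shifts the window, which
  trades the term \<open>i div m\<close> for \<open>(i + m) div m\<close>, larger by one.\<close>

lemma sum_shifted_div:
  fixes i m :: nat
  assumes "0 < m"
  shows "(\<Sum>x<m. (i + x) div m) = i"
proof (induction i)
  case (Suc i)
  have "(\<Sum>x<Suc m. (i + x) div m) = i div m + (\<Sum>x<m. (Suc i + x) div m)"
    by (subst sum.lessThan_Suc_shift) simp
  moreover have "(\<Sum>x<Suc m. (i + x) div m) = i + Suc (i div m)"
    using Suc.IH assms by simp
  ultimately show ?case by simp
qed simp

fun join_rel :: "('g \<Rightarrow> 'g \<Rightarrow> bool) \<Rightarrow> 'g + nat \<times> nat \<Rightarrow> 'g + nat \<times> nat \<Rightarrow> bool" where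
  "join_rel r (Inl u) (Inl v) = r u v"
| "join_rel r (Inr p) (Inr q) = (fst p = fst q)"
| "join_rel r _ _ = False"

definition join_verts :: "'g set \<Rightarrow> nat set \<Rightarrow> (nat \<Rightarrow> nat) \<Rightarrow> ('g + nat \<times> nat) set" where
  "join_verts X I m = X <+> (SIGMA i:I. {..<m i})"

lemma join_nbhd:
  "{w\<in>join_verts X I m. join_rel r (Inl u) w} = Inl ` {w\<in>X. r u w}"
  "i \<in> I \<Longrightarrow> {w\<in>join_verts X I m. join_rel r (Inr (i, x)) w} = (\<lambda>y. Inr (i, y)) ` {..<m i}"
  by (auto simp: join_verts_def)

lemma closed_sum_join:
  "closed_sum (join_verts X I m) (join_rel r) l (Inl u) = closed_sum X r (l \<circ> Inl) u"
  "i \<in> I \<Longrightarrow> closed_sum (join_verts X I m) (join_rel r) l (Inr (i, x)) = (\<Sum>y<m i. l (Inr (i, y)))"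
  by (simp_all add: closed_sum_def join_nbhd sum.reindex inj_on_def)

lemma reflp_on_join_rel:
  assumes "reflp_on X r"
  shows "reflp_on (join_verts X I m) (join_rel r)"
  using assms by (auto simp: reflp_on_def join_verts_def)

lemma symp_on_join_rel:
  assumes "symp_on X r"
  shows "symp_on (join_verts X I m) (join_rel r)"
  using assms by (auto simp: symp_on_def join_verts_def)

lemma finite_join_verts: "finite X \<Longrightarrow> finite I \<Longrightarrow> finite (join_verts X I m)"
  by (auto simp: join_verts_def)

text \<open>All vertices of a clique have the same closed sum, so each clique acts as a single
  value, to be kept apart from those of the other cliques and of the gadget. Nonempty cliques
  provide the representative \<open>Inr (i, 0)\<close>.\<close>

lemma additive_labeling_join:
  assumes "finite X" "finite I" "\<And>i. i \<in> I \<Longrightarrow> 0 < m i"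
  shows "additive_labeling (co_graph (join_verts X I m) (join_rel r)) l \<longleftrightarrow>
    additive_labeling (co_graph X r) (l \<circ> Inl) \<and>
    (\<forall>i\<in>I. \<forall>y<m i. 1 \<le> l (Inr (i, y))) \<and>
    inj_on (\<lambda>i. \<Sum>y<m i. l (Inr (i, y))) I \<and>
    (\<forall>u\<in>X. \<forall>i\<in>I. closed_sum X r (l \<circ> Inl) u \<noteq> (\<Sum>y<m i. l (Inr (i, y))))"
    (is "?L \<longleftrightarrow> ?R")
proof -
  let ?V = "join_verts X I m"
  let ?T = "closed_sum ?V (join_rel r) l"
  let ?s = "\<lambda>i. \<Sum>y<m i. l (Inr (i, y))"
  have V: "x \<in> ?V \<longleftrightarrow> (\<exists>u\<in>X. x = Inl u) \<or> (\<exists>i\<in>I. \<exists>y<m i. x = Inr (i, y))" for x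
    by (auto simp: join_verts_def)
  have fV: "finite ?V" by (simp add: finite_join_verts assms)
  show ?thesis
  proof
    assume ?L
    then have pos: "\<forall>v\<in>?V. 1 \<le> l v"
      and neq: "\<And>u v. u \<in> ?V \<Longrightarrow> v \<in> ?V \<Longrightarrow> \<not> join_rel r u v \<Longrightarrow> ?T u \<noteq> ?T v"
      by (auto simp: additive_labeling_co_graph[OF fV])
    have "additive_labeling (co_graph X r) (l \<circ> Inl)"
      unfolding additive_labeling_co_graph[OF assms(1)]
    proof (intro conjI ballI impI)
      fix u v assume "u \<in> X" "v \<in> X" "\<not> r u v"
      then show "closed_sum X r (l \<circ> Inl) u \<noteq> closed_sum X r (l \<circ> Inl) v"
        using neq[of "Inl u" "Inl v"] by (simp add: V closed_sum_join)
    qed (use pos in \<open>simp add: V\<close>)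
    moreover have "inj_on ?s I"
    proof (rule inj_onI, rule ccontr)
      fix i j assume "i \<in> I" "j \<in> I" "?s i = ?s j" "i \<noteq> j"
      then show False
        using neq[of "Inr (i, 0)" "Inr (j, 0)"] assms(3) by (simp add: V closed_sum_join)
    qed
    moreover have "closed_sum X r (l \<circ> Inl) u \<noteq> ?s i" if "u \<in> X" "i \<in> I" for u i
      using that neq[of "Inl u" "Inr (i, 0)"] assms(3) by (simp add: V closed_sum_join)
    ultimately show ?R using pos by (auto simp: V)
  next
    assume R: ?R
    show ?L
      unfolding additive_labeling_co_graph[OF fV]
    proof (intro conjI ballI impI)
      fix v assume "v \<in> ?V"
      then show "1 \<le> l v"
        using R by (auto simp: V additive_labeling_co_graph[OF assms(1)])
    next
      fix u v assume uv: "u \<in> ?V" "v \<in> ?V" and n: "\<not> join_rel r u v"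
      have X: "closed_sum X r (l \<circ> Inl) x \<noteq> closed_sum X r (l \<circ> Inl) y"
        if "x \<in> X" "y \<in> X" "\<not> r x y" for x y
        using R that by (simp add: additive_labeling_co_graph[OF assms(1)])
      have I: "?s i \<noteq> ?s j" if "i \<in> I" "j \<in> I" "i \<noteq> j" for i j
        using R that inj_onD[of ?s I i j] by blast
      have XI: "closed_sum X r (l \<circ> Inl) x \<noteq> ?s i" if "x \<in> X" "i \<in> I" for x i
        using R that by blast
      show "?T u \<noteq> ?T v"
      proof (cases u; cases v)
        fix x y assume "u = Inl x" "v = Inl y"
        then show ?thesis using X[of x y] uv n by (simp add: V closed_sum_join)
      next
        fix x q assume "u = Inl x" "v = Inr q"
        moreover from this uv obtain i z where "q = (i, z)" "i \<in> I" "x \<in> X" by (auto simp: V)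
        ultimately show ?thesis using XI[of x i] by (simp add: closed_sum_join)
      next
        fix p y assume "u = Inr p" "v = Inl y"
        moreover from this uv obtain i z where "p = (i, z)" "i \<in> I" "y \<in> X" by (auto simp: V)
        ultimately show ?thesis using XI[of y i] by (simp add: closed_sum_join)
      next
        fix p q assume "u = Inr p" "v = Inr q"
        moreover from this uv obtain i z j w where "p = (i, z)" "q = (j, w)" "i \<in> I" "j \<in> I"
          by (auto simp: V)
        ultimately show ?thesis using I[of i j] n by (simp add: closed_sum_join)
      qed
    qed
  qed
qed

text \<open>
  With all labels of the clique of index \<open>i\<close> chosen as \<open>(i + y) div min i t\<close>, its sum is \<open>i\<close>.
  The indices start above \<open>card X\<close> so that these sums exceed all degrees of the gadget, and
  there are more than \<open>(a - 1) * t\<close> cliques of size \<open>t\<close>, whose sums would all lie in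
  \<open>{t..(a - 1) * t}\<close> if the labels were less than \<open>a\<close>.
\<close>

definition graph_family :: "'g set \<Rightarrow> ('g \<Rightarrow> 'g \<Rightarrow> bool) \<Rightarrow> nat \<Rightarrow> nat \<Rightarrow> ('g + nat \<times> nat) pair_pre_digraph" where
  "graph_family X r a t =
     co_graph (join_verts X {card X<..a * t} (\<lambda>i. min i t)) (join_rel r)"

context
  fixes X :: "'g set" and r :: "'g \<Rightarrow> 'g \<Rightarrow> bool" and a t :: nat
  assumes fin: "finite X" and a: "1 \<le> a" and t: "card X < t"
begin

lemma additive_number_family:
  assumes ones: "additive_labeling (co_graph X r) (\<lambda>_. 1)"
  shows "additive_number (graph_family X r a t) = a"
  unfolding additive_number_eq
proof (rule Least_equality)
  let ?I = "{card X<..a * t}"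
  let ?m = "\<lambda>i. min i t"
  have pos: "0 < ?m i" if "i \<in> ?I" for i
    using that t by auto
  have al: "additive_labeling (co_graph (join_verts X ?I ?m) (join_rel r)) l \<longleftrightarrow>
      additive_labeling (co_graph X r) (l \<circ> Inl) \<and>
      (\<forall>i\<in>?I. \<forall>y<?m i. 1 \<le> l (Inr (i, y))) \<and>
      inj_on (\<lambda>i. \<Sum>y<?m i. l (Inr (i, y))) ?I \<and>
      (\<forall>u\<in>X. \<forall>i\<in>?I. closed_sum X r (l \<circ> Inl) u \<noteq> (\<Sum>y<?m i. l (Inr (i, y))))" for l
    by (rule additive_labeling_join[OF fin]) (use pos in auto)
  define l :: "'g + nat \<times> nat \<Rightarrow> nat" where
    "l = (\<lambda>v. case v of Inl _ \<Rightarrow> 1 | Inr (i, y) \<Rightarrow> (i + y) div ?m i)"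
  have s: "(\<Sum>y<?m i. l (Inr (i, y))) = i" if "i \<in> ?I" for i
    using sum_shifted_div[OF pos[OF that]] by (simp add: l_def)
  have range: "1 \<le> l (Inr (i, y)) \<and> l (Inr (i, y)) \<le> a" if "i \<in> ?I" "y < ?m i" for i y
  proof -
    have "?m i \<le> i + y" by simp
    then have "1 \<le> (i + y) div ?m i"
      using pos[OF that(1)] by (simp add: div_greater_zero_iff Suc_le_eq)
    \<comment> \<open>For \<open>i \<le> t\<close> the clique has size \<open>i\<close> and all its
      labels are 1; otherwise \<open>i \<le> a * t\<close> and \<open>y < t\<close> suffice.\<close>
    moreover have "i + y < Suc a * ?m i"
    proof (cases "i \<le> t")
      case True
      then have "i + y < 2 * ?m i" using that(2) by simp
      also have "\<dots> \<le> Suc a * ?m i" using a by (intro mult_le_mono1) simp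
      finally show ?thesis .
    next
      case False
      then show ?thesis using that by simp
    qed
    ultimately show ?thesis
      by (simp add: l_def less_mult_imp_div_less less_Suc_eq_le[symmetric])
  qed
  have "additive_labeling (graph_family X r a t) l"
    unfolding graph_family_def al
  proof (intro conjI)
    have "l \<circ> Inl = (\<lambda>_. 1)" by (auto simp: l_def)
    with ones show "additive_labeling (co_graph X r) (l \<circ> Inl)" by simp
    show "inj_on (\<lambda>i. \<Sum>y<?m i. l (Inr (i, y))) ?I"
      using s by (auto intro!: inj_onI)
    show "\<forall>u\<in>X. \<forall>i\<in>?I. closed_sum X r (l \<circ> Inl) u \<noteq> (\<Sum>y<?m i. l (Inr (i, y)))"
    proof (intro ballI)
      fix u i assume "u \<in> X" "i \<in> ?I"
      have "closed_sum X r (l \<circ> Inl) u = card {w\<in>X. r u w}"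
        by (simp add: closed_sum_def l_def)
      also have "\<dots> \<le> card X" by (rule card_mono) (use fin in auto)
      finally show "closed_sum X r (l \<circ> Inl) u \<noteq> (\<Sum>y<?m i. l (Inr (i, y)))"
        using s[OF \<open>i \<in> ?I\<close>] \<open>i \<in> ?I\<close> by simp
    qed
  qed (use range in auto)
  then show "1 \<le> a \<and> list_labelable (graph_family X r a t) (\<lambda>_. {1..a})"
    unfolding list_labelable_def using range a
    by (auto intro!: exI[of _ l] simp: graph_family_def join_verts_def l_def)
  fix k
  assume k: "1 \<le> k \<and> list_labelable (graph_family X r a t) (\<lambda>_. {1..k})"
  then obtain l where l: "additive_labeling (graph_family X r a t) l"
    and lk: "\<forall>v\<in>join_verts X ?I ?m. l v \<in> {1..k}"
    by (auto simp: list_labelable_def graph_family_def)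
  have sub: "{t..a * t} \<subseteq> ?I" using t by auto
  have "inj_on (\<lambda>i. \<Sum>y<?m i. l (Inr (i, y))) {t..a * t}"
    using l inj_on_subset[OF _ sub] unfolding graph_family_def al by blast
  moreover have "(\<lambda>i. \<Sum>y<?m i. l (Inr (i, y))) ` {t..a * t} \<subseteq> {t..k * t}"
  proof (rule image_subsetI)
    fix i assume i: "i \<in> {t..a * t}"
    have lb: "l (Inr (i, y)) \<in> {1..k}" if "y < t" for y
    proof -
      have "Inr (i, y) \<in> join_verts X ?I ?m"
        using i subsetD[OF sub i] that by (auto simp: join_verts_def)
      then show ?thesis using lk by blast
    qed
    then show "(\<Sum>y<?m i. l (Inr (i, y))) \<in> {t..k * t}"
      using i sum_bounded_below[of "{..<t}" 1 "\<lambda>y. l (Inr (i, y))"]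
        sum_bounded_above[of "{..<t}" "\<lambda>y. l (Inr (i, y))" k]
      by (auto simp: mult.commute min_def)
  qed
  ultimately have "card {t..a * t} \<le> card {t..k * t}"
    by (rule card_inj_on_le) simp
  \<comment> \<open>Makes the truncated subtractions in the two cardinalities exact.\<close>
  moreover have "t \<le> k * t" "t \<le> a * t" using k a by simp_all
  ultimately have "a * t \<le> k * t" unfolding card_atLeastAtMost by linarith
  then show "a \<le> k" using t by simp
qed

text \<open>The gadget is a union of components of the complement, so an additive labeling restricts
  to one of the gadget, whatever lists the cliques have.\<close>

lemma not_choosable_family:
  assumes "\<not> choosable (co_graph X r) k"
  shows "\<not> choosable (graph_family X r a t) k"
proof
  assume ch: "choosable (graph_family X r a t) k"
  have "choosable (co_graph X r) k"
    unfolding choosable_def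
  proof (intro allI impI)
    fix L :: "'g \<Rightarrow> nat set"
    assume L: "\<forall>v\<in>pverts (co_graph X r). L v \<subseteq> {1..} \<and> card (L v) = k"
    let ?L = "case_sum L (\<lambda>_. {1..k})"
    have "\<forall>v\<in>pverts (graph_family X r a t). ?L v \<subseteq> {1..} \<and> card (?L v) = k"
      using L by (auto simp: graph_family_def join_verts_def subset_iff)
    then have "list_labelable (graph_family X r a t) ?L"
      using ch unfolding choosable_def by blast
    then obtain l where l: "additive_labeling (graph_family X r a t) l"
      "\<forall>v\<in>pverts (graph_family X r a t). l v \<in> ?L v"
      unfolding list_labelable_def by blast
    have "additive_labeling (co_graph X r) (l \<circ> Inl)"
      using l(1) t unfolding graph_family_def
      by (subst (asm) additive_labeling_join[OF fin]) auto
    moreover have "(l \<circ> Inl) v \<in> L v" if "v \<in> X" for v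
      using that bspec[OF l(2), of "Inl v"] by (simp add: graph_family_def join_verts_def InlI)
    ultimately show "list_labelable (co_graph X r) L"
      unfolding list_labelable_def co_graph_simps by blast
  qed
  with assms show False by simp
qed

lemma pair_graph_family:
  assumes "reflp_on X r" "symp_on X r"
  shows "pair_graph (graph_family X r a t)"
  unfolding graph_family_def
  by (intro pair_graph_co_graph finite_join_verts reflp_on_join_rel symp_on_join_rel fin assms) simp

section \<open>Order and minimum degree of the family\<close>

text \<open>Closed degrees in the complement are at most \<open>card X < t\<close> in the gadget and
  at most \<open>t\<close> in the cliques, with equality in the clique of index
  \<open>t\<close>.\<close>

lemma min_degree_family:
  "min_degree (graph_family X r a t) + t = card (pverts (graph_family X r a t))"
proof -
  let ?V = "join_verts X {card X<..a * t} (\<lambda>i. min i t)"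
  have tt: "t \<in> {card X<..a * t}" using a t by simp
  have "min_degree (co_graph ?V (join_rel r)) + t = card ?V"
  proof (rule min_degree_co_graph)
    show "finite ?V" by (simp add: finite_join_verts fin)
    show "Inr (t, 0) \<in> ?V" using tt t by (auto simp: join_verts_def)
    show "card {w\<in>?V. join_rel r (Inr (t, 0)) w} = t"
      using tt by (simp add: join_nbhd card_image inj_on_def)
    fix v assume "v \<in> ?V"
    then consider u where "v = Inl u" | i y where "v = Inr (i, y)" "i \<in> {card X<..a * t}"
      by (auto simp: join_verts_def)
    then show "card {w\<in>?V. join_rel r v w} \<le> t"
    proof cases
      case 1
      have "card {w\<in>X. r u w} \<le> card X" by (rule card_mono) (use fin in auto)
      then show ?thesis using 1 t by (simp add: join_nbhd card_image)
    next
      case 2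
      then show ?thesis by (simp add: join_nbhd card_image inj_on_def)
    qed
  qed
  then show ?thesis by (simp add: graph_family_def)
qed

text \<open>Doubled and free of subtraction. For a fixed gadget, twice the order is
  \<open>(2 * a - 1) * t * t\<close> up to a term linear in \<open>t\<close>.\<close>

lemma card_verts_family:
  "2 * card (pverts (graph_family X r a t)) + card X * (card X + 1) + t * t
     = 2 * a * (t * t) + t + 2 * card X"
proof -
  let ?q = "card X"
  have "card (pverts (graph_family X r a t)) = ?q + (\<Sum>i\<in>{?q<..a * t}. min i t)"
    by (simp add: graph_family_def join_verts_def card_Plus fin)
  also have "{?q<..a * t} = {?q<..t} \<union> {t<..a * t}"
  proof -
    have "t \<le> a * t" using a by simp
    then have "x \<le> a * t" if "x \<le> t" for x using that by (rule order_trans[rotated])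
    then show ?thesis using t by auto
  qed
  also have "(\<Sum>i\<in>\<dots>. min i t) = (\<Sum>i\<in>{?q<..t}. i) + (a * t - t) * t"
    by (subst sum.union_disjoint) auto
  finally have 1: "card (pverts (graph_family X r a t)) = ?q + (\<Sum>i\<in>{?q<..t}. i) + (a * t - t) * t"
    by simp
  have "{..t} = {..?q} \<union> {?q<..t}" using t by auto
  then have "(\<Sum>i\<le>t. i) = (\<Sum>i\<le>?q. i) + (\<Sum>i\<in>{?q<..t}. i)"
    by (simp add: sum.union_disjoint ivl_disj_int)
  moreover have g: "2 * (\<Sum>i\<le>n. i) = n * (n + 1)" for n :: nat
    by (induction n) auto
  ultimately have 2: "t * (t + 1) = ?q * (?q + 1) + 2 * (\<Sum>i\<in>{?q<..t}. i)"
    using g[of t] g[of ?q] by simp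
  have 3: "(a * t - t) * t + t * t = a * (t * t)"
    using a by (cases a) (simp_all add: algebra_simps)
  show ?thesis
    using 1 2 3 by (simp add: algebra_simps)
qed

text \<open>The minimum degree is the order minus \<open>t\<close>, so \<open>t\<close> is compared
  with the root of \<open>y = 2 * n / (2 * a - 1)\<close>. Here \<open>y - t * t\<close> is at most
  linear in \<open>t\<close>, and dividing by \<open>sqrt y + t \<ge> t\<close> leaves a bound
  independent of \<open>t\<close>.\<close>

lemma min_degree_family_bound:
  fixes n :: real
  defines "n \<equiv> real (card (pverts (graph_family X r a t)))"
  shows "\<bar>real (min_degree (graph_family X r a t)) - n + sqrt (2 * n / (2 * real a - 1))\<bar>
    \<le> 1 + real (card X) * (real (card X) + 1)"
proof -
  define q T d where "q = real (card X)" and "T = real t" and "d = 2 * real a - 1"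
  define y where "y = 2 * n / d"
  have d: "1 \<le> d" using a by (simp add: d_def)
  have T: "1 \<le> T" "q \<le> T" using t by (simp_all add: T_def q_def)
  have q: "0 \<le> q" by (simp add: q_def)
  have y0: "0 \<le> y" using d by (simp add: y_def n_def)
  have "real (2 * card (pverts (graph_family X r a t)) + card X * (card X + 1) + t * t)
      = real (2 * a * (t * t) + t + 2 * card X)"
    by (simp only: card_verts_family)
  then have "2 * n = d * (T * T) + T + q - q * q"
    by (simp add: n_def q_def T_def d_def algebra_simps)
  moreover have "d * y = 2 * n"
    using d by (simp add: y_def)
  ultimately have "d * (y - T * T) = T + q - q * q"
    by (simp add: right_diff_distrib)
  then have eq: "y - T * T = (T + q - q * q) / d"
    using d by (simp add: field_simps)
  have "\<bar>T + q - q * q\<bar> \<le> T + q * (q + 1)"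
    using T q by (simp add: abs_le_iff algebra_simps) 
  moreover have "\<bar>y - T * T\<bar> \<le> \<bar>T + q - q * q\<bar> / 1"
    unfolding eq abs_divide using d by (intro divide_left_mono) auto
  ultimately have "\<bar>y - T * T\<bar> \<le> T + q * (q + 1)"
    by simp
  also have "\<dots> \<le> (1 + q * (q + 1)) * T"
    using T q mult_left_mono[of 1 T "q * (q + 1)"] by (simp add: algebra_simps)
  finally have "\<bar>y - T * T\<bar> \<le> (1 + q * (q + 1)) * T" .
  moreover have "\<bar>y - T * T\<bar> = \<bar>sqrt y - T\<bar> * (sqrt y + T)"
  proof -
    have "y - T * T = (sqrt y - T) * (sqrt y + T)"
      using y0 by (simp add: algebra_simps)
    then show ?thesis using y0 T by (simp add: abs_mult)
  qed
  moreover have "\<bar>sqrt y - T\<bar> * T \<le> \<bar>sqrt y - T\<bar> * (sqrt y + T)"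
    using y0 by (intro mult_left_mono) auto
  ultimately have "\<bar>sqrt y - T\<bar> * T \<le> (1 + q * (q + 1)) * T" by linarith
  then have "\<bar>sqrt y - T\<bar> \<le> 1 + q * (q + 1)" using T by simp
  moreover have "real (min_degree (graph_family X r a t)) + T = n"
    using min_degree_family by (simp add: n_def T_def flip: of_nat_add)
  ultimately show ?thesis
    by (simp add: y_def d_def q_def algebra_simps)
qed

lemma card_verts_family_ge: "t \<le> card (pverts (graph_family X r a t))"
  using min_degree_family by simp

end

subsection \<open>A gadget of bounded order that is not choosable\<close>

lemma popular_value:
  fixes c :: "nat \<Rightarrow> nat"
  assumes "1 \<le> k" "\<And>j. j < k * u \<Longrightarrow> c j \<in> {1..k}"
  shows "\<exists>p\<in>{1..k}. u \<le> card {j\<in>{..<k * u}. c j = p}"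
proof (rule ccontr)
  assume "\<not> ?thesis"
  then have *: "card {j\<in>{..<k * u}. c j = p} < u" if "p \<in> {1..k}" for p
    using that by (meson not_le)
  have "card {..<k * u} \<le> card (\<Union>p\<in>{1..k}. {j\<in>{..<k * u}. c j = p})"
    using assms(2) by (intro card_mono) auto
  also have "\<dots> \<le> (\<Sum>p\<in>{1..k}. card {j\<in>{..<k * u}. c j = p})"
    by (rule card_UN_le) simp
  also have "\<dots> < (\<Sum>p\<in>{1..k}. u)"
    using assms(1) * by (intro sum_strict_mono) auto
  finally show False by simp
qed

text \<open>The first prefix sum that reaches \<open>x\<close> overshoots it by some
  \<open>y \<le> g\<close>. Each further step raises the residue modulo \<open>p\<close> by one, so
  fewer than \<open>p\<close> steps make the excess divisible by \<open>p\<close>.\<close>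

lemma chain_hits_residue:
  fixes a :: "nat \<Rightarrow> nat"
  assumes "0 < p" and a: "\<And>i. i < N \<Longrightarrow> a i = 1 + p * b i" "\<And>i. i < N \<Longrightarrow> a i \<le> g"
    and x: "x \<le> (\<Sum>i<m. a i)" and m: "m + p \<le> N"
  shows "\<exists>n\<le>N. \<exists>d\<le>g. (\<Sum>i<n. a i) = x + p * d"
proof -
  define i0 where "i0 = (LEAST n. x \<le> (\<Sum>i<n. a i))"
  have i0: "x \<le> (\<Sum>i<i0. a i)" "i0 \<le> m"
    unfolding i0_def
    by (rule LeastI[of "\<lambda>n. x \<le> (\<Sum>i<n. a i)"], rule x)
      (rule Least_le[of "\<lambda>n. x \<le> (\<Sum>i<n. a i)"], rule x)
  define y where "y = (\<Sum>i<i0. a i) - x"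
  have y: "(\<Sum>i<i0. a i) = x + y" using i0 by (simp add: y_def)
  have yg: "y \<le> g"
  proof (cases i0)
    case 0
    then show ?thesis using y by simp
  next
    case (Suc j)
    then have "j < i0" by simp
    then have "\<not> x \<le> (\<Sum>i<j. a i)" unfolding i0_def by (rule not_less_Least)
    moreover have "a j \<le> g" using Suc i0(2) m a(2) by simp
    moreover have "(\<Sum>i<i0. a i) = (\<Sum>i<j. a i) + a j" using Suc by simp
    ultimately show ?thesis using y by linarith
  qed
  \<comment> \<open>The number of further steps; the outer \<open>mod\<close> covers the case that
    \<open>p\<close> divides \<open>y\<close> already.\<close>
  define r where "r = (p - y mod p) mod p"
  have r: "r < p" using assms(1) by (simp add: r_def)
  have "(y + r) mod p = (y mod p + (p - y mod p)) mod p"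
    by (simp only: r_def mod_add_left_eq mod_add_right_eq)
  also have "y mod p + (p - y mod p) = p"
    using assms(1) by (simp add: less_imp_le)
  finally have "p dvd y + r" by (simp add: dvd_eq_mod_eq_0)
  then obtain e where e: "y + r = p * e" by (elim dvdE)
  have step: "(\<Sum>i<i0 + s. a i) = x + y + s + p * (\<Sum>i\<in>{i0..<i0 + s}. b i)
      \<and> (\<Sum>i<i0 + s. a i) \<le> x + y + s * g" if "s \<le> p" for s
    using that
  proof (induction s)
    case 0
    then show ?case using y by simp
  next
    case (Suc s)
    then have "i0 + s < N" using i0(2) m by simp
    note ai = a[OF this]
    have IH: "(\<Sum>i<i0 + s. a i) = x + y + s + p * (\<Sum>i\<in>{i0..<i0 + s}. b i)"
      "(\<Sum>i<i0 + s. a i) \<le> x + y + s * g"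
      using Suc by simp_all
    have "(\<Sum>i<i0 + Suc s. a i) = (\<Sum>i<i0 + s. a i) + a (i0 + s)"
      "(\<Sum>i\<in>{i0..<i0 + Suc s}. b i) = (\<Sum>i\<in>{i0..<i0 + s}. b i) + b (i0 + s)"
      by simp_all
    then show ?case
      using ai IH by (simp only: distrib_left mult_Suc, intro conjI; linarith)
  qed
  define d where "d = e + (\<Sum>i\<in>{i0..<i0 + r}. b i)"
  note st = step[OF less_imp_le[OF r]]
  have "(\<Sum>i<i0 + r. a i) = x + (y + r) + p * (\<Sum>i\<in>{i0..<i0 + r}. b i)"
    using st by linarith
  then have sum: "(\<Sum>i<i0 + r. a i) = x + p * d"
    unfolding e by (simp only: d_def distrib_left add.assoc)
  \<comment> \<open>The excess consists of \<open>y\<close> and \<open>r\<close> steps, each at most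
    \<open>g\<close>, and \<open>Suc r \<le> p\<close>.\<close>
  then have "p * d \<le> y + r * g" using st by linarith
  also have "\<dots> \<le> Suc r * g" using yg by simp
  also have "\<dots> \<le> p * g" using r by (intro mult_le_mono1) simp
  finally have "d \<le> g" using assms(1) by simp
  moreover have "i0 + r \<le> N" using r i0(2) m by simp
  ultimately show ?thesis using sum by blast
qed

text \<open>An upper bound for the labels that the bad lists offer on the core vertices of the chain.\<close>

definition incr :: "nat \<Rightarrow> nat" where
  "incr k = 1 + 3 * k * fact k"

text \<open>
  The partial sums of \<open>a\<close> increase by steps that are 1 modulo every \<open>p \<le> k\<close>, so they meet every
  residue class modulo a value \<open>p\<close> that \<open>c\<close> takes often.
\<close>

lemma chain_subset_collision:
  fixes a c :: "nat \<Rightarrow> nat"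
  assumes k: "1 \<le> k" and N: "2 * k + 1 + F \<le> N"
    and a: "\<And>i. i < N \<Longrightarrow> a i \<in> (\<lambda>j. 1 + fact k * j) ` {2 * k<..3 * k}"
    and c: "\<And>j. j < k * incr k \<Longrightarrow> c j \<in> {1..k}"
    and x: "x \<le> k * (N + 1 + F)"
  shows "\<exists>n\<le>N. \<exists>D\<subseteq>{..<k * incr k}. (\<Sum>i<n. a i) = x + (\<Sum>j\<in>D. c j)"
proof -
  obtain p where p: "p \<in> {1..k}" "incr k \<le> card {j\<in>{..<k * incr k}. c j = p}"
    using popular_value[OF k, of "incr k" c] c by blast
  then have "p dvd fact k" by (simp add: dvd_fact)
  then obtain f where f: "fact k = p * f" by (elim dvdE)
  have "\<forall>i. \<exists>j. i < N \<longrightarrow> a i = 1 + fact k * j \<and> j \<in> {2 * k<..3 * k}"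
    using a by blast
  from choice[OF this] obtain b
    where b: "\<And>i. i < N \<Longrightarrow> a i = 1 + fact k * b i \<and> b i \<in> {2 * k<..3 * k}"
    by blast
  \<comment> \<open>Every term is at least \<open>2 * k\<close>, and
    \<open>N + 1 + F \<le> 2 * (N - k)\<close>, so the first \<open>N - k\<close> terms reach
    \<open>x\<close>; the remaining \<open>k \<ge> p\<close> terms serve to adjust the
    residue.\<close>
  have "x \<le> (\<Sum>i<N - k. a i)"
  proof -
    have "2 * k \<le> a i" if "i < N" for i
    proof -
      have "2 * k \<le> 1 * b i" using b[OF that] by simp
      also have "\<dots> \<le> fact k * b i" by (intro mult_le_mono1 fact_ge_1)
      finally show ?thesis using b[OF that] by simp
    qed
    then have "(\<Sum>i<N - k. 2 * k) \<le> (\<Sum>i<N - k. a i)"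
      by (intro sum_mono) auto
    moreover have "k * (N + 1 + F) \<le> k * (2 * (N - k))"
      using N by (intro mult_le_mono2) simp
    ultimately show ?thesis using x by (simp add: algebra_simps)
  qed
  moreover have "a i = 1 + p * (f * b i)" if "i < N" for i
    using b[OF that] f by simp
  moreover have "a i \<le> incr k" if "i < N" for i
  proof -
    have "fact k * b i \<le> fact k * (3 * k)" using b[OF that] by (intro mult_le_mono2) simp
    then show ?thesis using b[OF that] by (simp add: incr_def algebra_simps)
  qed
  moreover have "N - k + p \<le> N" using p N unfolding atLeastAtMost_iff by linarith
  ultimately obtain n d where n: "n \<le> N" "d \<le> incr k" "(\<Sum>i<n. a i) = x + p * d"
    using chain_hits_residue[of p N a "\<lambda>i. f * b i" "incr k" x "N - k"] p by auto
  \<comment> \<open>\<open>p\<close> occurs at least \<open>incr k \<ge> d\<close> times, so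
    \<open>d\<close> of its occurrences form a subset with sum \<open>p * d\<close>.\<close>
  obtain D where D: "D \<subseteq> {j\<in>{..<k * incr k}. c j = p}" "card D = d"
    by (rule obtain_subset_with_card_n[OF order_trans[OF n(2) p(2)]])
  have "(\<Sum>j\<in>D. c j) = (\<Sum>j\<in>D. p)"
    using D by (intro sum.cong) auto
  then have "(\<Sum>i<n. a i) = x + (\<Sum>j\<in>D. c j)"
    using n D by simp
  moreover have "D \<subseteq> {..<k * incr k}" using D by blast
  ultimately show ?thesis using n(1) by blast
qed

section \<open>The gadget\<close>

text \<open>
  The relation \<open>gadj h\<close> is adjacency in the complement of the gadget. The cores below \<open>h\<close> are
  joined to the vertices \<open>Sub D\<close>, the next ones to the vertices \<open>Chain n\<close>; the remaining
  cores only raise the degrees of all cores above those of the other vertices.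
\<close>

datatype gvert = Core nat | Chain nat | Sub "nat set"

fun gadj :: "nat \<Rightarrow> gvert \<Rightarrow> gvert \<Rightarrow> bool" where
  "gadj h (Core i) (Chain n) = (h \<le> i \<and> i < h + n)"
| "gadj h (Chain n) (Core i) = (h \<le> i \<and> i < h + n)"
| "gadj h (Core i) (Sub D) = (i \<in> D)"
| "gadj h (Sub D) (Core i) = (i \<in> D)"
| "gadj h (Chain n) (Sub D) = False"
| "gadj h (Sub D) (Chain n) = False"
| "gadj h (Core i) (Core j) = True"
| "gadj h (Chain m) (Chain n) = True"
| "gadj h (Sub D) (Sub E) = True"

text \<open>There are \<open>2 * N + 2\<close> cores because, with constant label 1, the sums of
  \<open>Chain\<close> vertices go up to \<open>2 * N + 1\<close>.\<close>

definition gverts :: "nat \<Rightarrow> nat \<Rightarrow> gvert set" where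
  "gverts h N = Core ` {..<2 * N + 2} \<union> Chain ` {..N} \<union> Sub ` Pow {..<h}"

lemma finite_gverts: "finite (gverts h N)"
  by (simp add: gverts_def)

lemma reflp_on_gadj: "reflp_on X (gadj h)"
proof (rule reflp_onI)
  show "gadj h x x" for x by (cases x) auto
qed

lemma symp_on_gadj: "symp_on X (gadj h)"
proof (rule symp_onI)
  show "gadj h y x" if "gadj h x y" for x y using that by (cases x; cases y) auto
qed

lemma gverts_nbhd_Chain:
  assumes "n \<le> N" "h \<le> N"
  shows "{w\<in>gverts h N. gadj h (Chain n) w} = Chain ` {..N} \<union> (\<lambda>i. Core (h + i)) ` {..<n}"
proof -
  have "Core i \<in> (\<lambda>i. Core (h + i)) ` {..<n}" if "h \<le> i" "i < h + n" for i
    using that by (intro image_eqI[of _ _ "i - h"]) auto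
  then show ?thesis using assms by (auto simp: gverts_def)
qed

lemma gverts_nbhd_Sub:
  assumes "D \<subseteq> {..<h}" "h \<le> N"
  shows "{w\<in>gverts h N. gadj h (Sub D) w} = Sub ` Pow {..<h} \<union> Core ` D"
  using assms by (auto simp: gverts_def)

lemma closed_sum_Chain:
  assumes "n \<le> N" "h \<le> N"
  shows "closed_sum (gverts h N) (gadj h) l (Chain n)
    = (\<Sum>m\<le>N. l (Chain m)) + (\<Sum>i<n. l (Core (h + i)))"
  unfolding closed_sum_def gverts_nbhd_Chain[OF assms]
  by (subst sum.union_disjoint) (auto simp: sum.reindex inj_on_def)

lemma closed_sum_Sub:
  assumes "D \<subseteq> {..<h}" "h \<le> N"
  shows "closed_sum (gverts h N) (gadj h) l (Sub D)
    = (\<Sum>E\<in>Pow {..<h}. l (Sub E)) + (\<Sum>i\<in>D. l (Core i))"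
  unfolding closed_sum_def gverts_nbhd_Sub[OF assms]
  using finite_subset[OF assms(1)]
  by (subst sum.union_disjoint) (auto simp: sum.reindex inj_on_def)

lemma closed_sum_Core_ge:
  "2 * N + 2 \<le> closed_sum (gverts h N) (gadj h) (\<lambda>_. 1) (Core i)"
proof -
  have "card (Core ` {..<2 * N + 2}) \<le> card {w\<in>gverts h N. gadj h (Core i) w}"
    by (intro card_mono) (auto simp: finite_gverts, auto simp: gverts_def)
  then show ?thesis by (simp add: closed_sum_def card_image inj_on_def)
qed

text \<open>Vertices of one kind are adjacent in the complement, so it suffices that the sums
  separate the kinds: \<open>Sub\<close> at most \<open>2 ^ h + h \<le> N\<close>,
  \<open>Chain\<close> from \<open>N + 1\<close> to \<open>2 * N + 1\<close>, \<open>Core\<close>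
  above that.\<close>

lemma additive_labeling_gadget_one:
  assumes N: "2 ^ h + h \<le> N"
  shows "additive_labeling (co_graph (gverts h N) (gadj h)) (\<lambda>_. 1)"
proof -
  let ?T = "closed_sum (gverts h N) (gadj h) (\<lambda>_. 1)"
  have hN: "h \<le> N" using N by simp
  have T_Chain: "N + 1 \<le> ?T (Chain n)" "?T (Chain n) \<le> 2 * N + 1" if "n \<le> N" for n
    using that by (simp_all add: closed_sum_Chain hN)
  have T_Sub: "?T (Sub D) \<le> N" if "D \<subseteq> {..<h}" for D
    using that N card_mono[OF _ that] by (simp add: closed_sum_Sub hN card_Pow)
  have T_Core: "2 * N + 2 \<le> ?T (Core i)" for i
    by (rule closed_sum_Core_ge)
  have level: "case u of Core _ \<Rightarrow> 2 * N + 2 \<le> ?T u | Chain _ \<Rightarrow> N < ?T u \<and> ?T u < 2 * N + 2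
      | Sub _ \<Rightarrow> ?T u \<le> N" if "u \<in> gverts h N" for u
  proof (cases u)
    case (Chain n)
    then have "n \<le> N" using that by (auto simp: gverts_def)
    then show ?thesis using T_Chain[of n] Chain by simp
  next
    case (Sub D)
    then have "D \<subseteq> {..<h}" using that by (auto simp: gverts_def)
    then show ?thesis using T_Sub[of D] Sub by simp
  qed (use T_Core in simp)
  have "?T u \<noteq> ?T v" if "u \<in> gverts h N" "v \<in> gverts h N" "\<not> gadj h u v" for u v
    using level[OF that(1)] level[OF that(2)] that(3) by (cases u; cases v) auto
  then show ?thesis
    by (simp add: additive_labeling_co_graph finite_gverts)
qed

text \<open>Suitable lists force some \<open>Chain n\<close> and some \<open>Sub D\<close>, never
  adjacent in the complement, to have equal sums. The bound on \<open>N\<close> makes the chain long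
  enough to absorb the offset between the two cliques.\<close>

lemma not_choosable_gadget:
  assumes k: "1 \<le> k" and h: "h = k * incr k" and N: "2 * k + 1 + 2 ^ h + h \<le> N"
  shows "\<not> choosable (co_graph (gverts h N) (gadj h)) k"
proof
  let ?G = "co_graph (gverts h N) (gadj h)"
  let ?T = "closed_sum (gverts h N) (gadj h)"
  assume ch: "choosable ?G k"
  define Y where "Y = k * (N + 1)"
  \<comment> \<open>the shift by \<open>Y\<close> at \<open>Sub {}\<close> makes the sums of the subset side start above those of the chain\<close>
  define L :: "gvert \<Rightarrow> nat set" where
    "L = (\<lambda>v. case v of
        Core i \<Rightarrow> if h \<le> i \<and> i < h + N then (\<lambda>j. 1 + fact k * j) ` {2 * k<..3 * k} else {1..k}
      | Chain _ \<Rightarrow> {1..k}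
      | Sub D \<Rightarrow> if D = {} then {Y + 1..Y + k} else {1..k})"
  have "L v \<subseteq> {1..} \<and> card (L v) = k" for v
    by (cases v) (auto simp: L_def card_image inj_on_def)
  then obtain l where l: "additive_labeling ?G l" "\<And>v. v \<in> gverts h N \<Longrightarrow> l v \<in> L v"
    using ch unfolding choosable_def list_labelable_def by (metis co_graph_simps(1))
  have hN: "h \<le> N" using N by simp
  define SA where "SA = (\<Sum>m\<le>N. l (Chain m))"
  define SB where "SB = (\<Sum>E\<in>Pow {..<h}. l (Sub E))"
  have SA: "SA \<le> Y"
  proof -
    have "l (Chain m) \<le> k" if "m \<le> N" for m
      using that l(2)[of "Chain m"] by (auto simp: L_def gverts_def)
    then show ?thesis
      using sum_bounded_above[of "{..N}" "\<lambda>m. l (Chain m)" k]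
      by (simp add: SA_def Y_def mult.commute)
  qed
  have lS: "l (Sub E) \<in> L (Sub E)" if "E \<subseteq> {..<h}" for E
    using that l(2)[of "Sub E"] by (simp add: gverts_def)
  have l0: "Y + 1 \<le> l (Sub {})" "l (Sub {}) \<le> Y + k"
    using lS[of "{}"] by (auto simp: L_def)
  \<comment> \<open>Only \<open>Sub {}\<close> has a shifted list, so its label is bounded apart
    from the others.\<close>
  have SB: "SB = l (Sub {}) + (\<Sum>E\<in>Pow {..<h} - {{}}. l (Sub E))"
    unfolding SB_def by (subst sum.remove[of _ "{}"]) simp_all
  have "l (Sub E) \<le> k" if "E \<in> Pow {..<h} - {{}}" for E
    using that lS[of E] by (auto simp: L_def)
  then have "(\<Sum>E\<in>Pow {..<h} - {{}}. l (Sub E)) \<le> card (Pow {..<h} - {{}}) * k"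
    using sum_bounded_above[of "Pow {..<h} - {{}}" "\<lambda>E. l (Sub E)" k] by simp
  also have "card (Pow {..<h} - {{}}) = 2 ^ h - 1"
    by (simp add: card_Pow)
  finally have "SB \<le> Y + (k + (2 ^ h - 1) * k)"
    unfolding SB using l0(2) by linarith
  also have "k + (2 ^ h - 1) * k = 2 ^ h * k"
    by (simp add: diff_mult_distrib)
  also have "Y + 2 ^ h * k = k * (N + 1 + 2 ^ h)"
    by (simp add: Y_def distrib_left)
  \<comment> \<open>The difference is not truncated, since \<open>SA \<le> Y < SB\<close>; it is the
    offset \<open>x\<close> of the collision lemma, with \<open>F = 2 ^ h\<close>.\<close>
  finally have "SB - SA \<le> k * (N + 1 + 2 ^ h)" by linarith
  moreover have "l (Core (h + i)) \<in> (\<lambda>j. 1 + fact k * j) ` {2 * k<..3 * k}" if "i < N" for i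
    using that hN l(2)[of "Core (h + i)"] by (auto simp: L_def gverts_def)
  moreover have "l (Core j) \<in> {1..k}" if "j < k * incr k" for j
    using that hN h l(2)[of "Core j"] by (auto simp: L_def gverts_def)
  moreover have "2 * k + 1 + 2 ^ h \<le> N" using N by simp
  ultimately obtain n D where nD: "n \<le> N" "D \<subseteq> {..<h}"
    "(\<Sum>i<n. l (Core (h + i))) = SB - SA + (\<Sum>j\<in>D. l (Core j))"
    using chain_subset_collision[OF k, of "2 ^ h" N "\<lambda>i. l (Core (h + i))" "\<lambda>j. l (Core j)" "SB - SA"]
    unfolding h by blast
  have "?T l (Chain n) = ?T l (Sub D)"
    using nD SA SB l0(1) by (simp add: closed_sum_Chain closed_sum_Sub hN flip: SA_def SB_def)
  moreover have "Chain n \<in> gverts h N" "Sub D \<in> gverts h N"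
    using nD by (auto simp: gverts_def)
  ultimately show False
    using l(1) unfolding additive_labeling_co_graph[OF finite_gverts]
    by (metis gadj.simps(5))
qed

section \<open>Assembly of the graphs\<close>

theorem corollary1:
  fixes a b :: nat
  assumes "1 \<le> a" and "2 \<le> b"
  shows "\<exists>C::real. \<forall>n0::nat. \<exists>G :: nat pair_pre_digraph.
           pair_graph G \<and> n0 \<le> card (pverts G) \<and>
           additive_number G = a \<and> list_additive_number G \<ge> b \<and>
           \<bar>real (min_degree G) - real (card (pverts G))
              + sqrt (2 * real (card (pverts G)) / (2 * real a - 1))\<bar> \<le> C"
proof -
  \<comment> \<open>A graph that is not \<open>k\<close>-choosable has list additive number at least
    \<open>k + 1 = b\<close>. The gadget \<open>X\<close> depends on \<open>b\<close> only, which
    makes the constant uniform in \<open>n0\<close>.\<close>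
  define k where "k = b - 1"
  define h where "h = k * incr k"
  define N where "N = 2 * k + 1 + 2 ^ h + h"
  define X where "X = gverts h N"
  let ?r = "gadj h"
  have k: "1 \<le> k" "b = Suc k" using assms(2) by (simp_all add: k_def)
  have fin: "finite X" by (simp add: X_def finite_gverts)
  have ones: "additive_labeling (co_graph X ?r) (\<lambda>_. 1)"
    unfolding X_def by (rule additive_labeling_gadget_one) (simp add: N_def)
  have nch: "\<not> choosable (co_graph X ?r) k"
    unfolding X_def by (rule not_choosable_gadget[OF k(1) h_def]) (simp add: N_def)
  show ?thesis
  proof (rule exI, rule allI)
    fix n0 :: nat
    \<comment> \<open>Above \<open>card X\<close>, as the family requires, and at least
      \<open>n0\<close>, since the order is at least \<open>t\<close>.\<close>
    define t where "t = Suc (card X) + n0"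
    have t: "card X < t" by (simp add: t_def)
    define G0 where "G0 = graph_family X ?r a t"
    have G0: "pair_graph G0"
      unfolding G0_def by (rule pair_graph_family[OF fin assms(1) t reflp_on_gadj symp_on_gadj])
    have eta: "additive_number G0 = a"
      unfolding G0_def by (rule additive_number_family[OF fin assms(1) t ones])
    have "\<not> choosable G0 k"
      unfolding G0_def by (rule not_choosable_family[OF fin assms(1) t nch])
    then have list: "b \<le> list_additive_number G0"
      unfolding k(2) by (intro Suc_leI list_additive_number_gt G0)
    have "t \<le> card (pverts G0)"
      unfolding G0_def by (rule card_verts_family_ge[OF fin assms(1) t])
    then have large: "n0 \<le> card (pverts G0)"
      unfolding t_def by linarith
    have "finite (pverts G0)"
      unfolding G0_def graph_family_def co_graph_simps by (rule finite_join_verts[OF fin]) simp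
    from finite_imp_inj_to_nat_seg[OF this]
    obtain f :: "gvert + nat \<times> nat \<Rightarrow> nat" where f: "inj_on f (pverts G0)"
      by (elim exE conjE)
    have card: "card (pverts (map_graph f G0)) = card (pverts G0)"
      by (simp add: card_image f)
    show "\<exists>G :: nat pair_pre_digraph.
           pair_graph G \<and> n0 \<le> card (pverts G) \<and>
           additive_number G = a \<and> list_additive_number G \<ge> b \<and>
           \<bar>real (min_degree G) - real (card (pverts G))
              + sqrt (2 * real (card (pverts G)) / (2 * real a - 1))\<bar>
            \<le> 1 + real (card X) * (real (card X) + 1)"
    proof (intro exI[of _ "map_graph f G0"] conjI)
      show "pair_graph (map_graph f G0)"
        by (rule pair_graph_map_graph[OF G0 f])
      show "n0 \<le> card (pverts (map_graph f G0))"
        unfolding card by (rule large)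
      show "additive_number (map_graph f G0) = a"
        unfolding additive_number_map_graph[OF G0 f] by (rule eta)
      show "b \<le> list_additive_number (map_graph f G0)"
        unfolding list_additive_number_map_graph[OF G0 f] by (rule list)
      show "\<bar>real (min_degree (map_graph f G0)) - real (card (pverts (map_graph f G0)))
          + sqrt (2 * real (card (pverts (map_graph f G0))) / (2 * real a - 1))\<bar>
        \<le> 1 + real (card X) * (real (card X) + 1)"
        unfolding card min_degree_map_graph[OF G0 f]
        unfolding G0_def
        by (rule min_degree_family_bound[OF fin assms(1) t])
    qed
  qed
qed

end
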